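(* Let $q$ be a power of a prime, $V=\mathbb{F}_q^2$, let $G$ be a group with $SL_2(V)<G\leq GL_2(V)$, and let $d=|\det(G)|$. Then every intersecting set of $G$ is contained in an intersecting set of $G$ of size $qd$.
   Context: $V=\mathbb{F}_q^2$ is the $2$-dimensional column vector space over the finite field $\mathbb{F}_q$, and $G$ acts naturally on it; $SL_2(V)<G$ means that $SL_2(V)$ is a proper subgroup of $G$. $\det(G)\subseteq\mathbb{F}_q^*$ is the set of determinants of all elements of $G$. A subset $A\subseteq G$ is intersecting if for all $\delta,\tau\in A$ there exists $u\in V\setminus\{0\}$ with $\delta(u)=\tau(u)$. *)

theory Defs
  imports "HOL-Analysis.Determinants" "HOL-Algebra.Group"
begin

definition GL :: "('a::field^'n^'n) monoid"
  where "GL = \<lparr>carrier = {A. invertible A}, mult = (**), one = mat 1\<rparr>"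

lemma group_GL: "group GL"
proof (rule groupI)
  fix A :: "'a::field^'n^'n" assume "A \<in> carrier GL"
  then obtain B where "A ** B = mat 1" "B ** A = mat 1"
    by (auto simp: GL_def invertible_def)
  then show "\<exists>B\<in>carrier GL. B \<otimes>\<^bsub>GL\<^esub> A = \<one>\<^bsub>GL\<^esub>"
    by (auto simp: GL_def invertible_def)
qed (auto simp: GL_def invertible_mult matrix_mul_assoc invertible_def[of "mat 1"])

definition SL :: "('a::field^'n^'n) set"
  where "SL = {A. det A = 1}"

definition intersecting :: "('a::field^'n^'n) set \<Rightarrow> bool"
  where "intersecting A \<longleftrightarrow> (\<forall>\<delta>\<in>A. \<forall>\<tau>\<in>A. \<exists>u. u \<noteq> 0 \<and> \<delta> *v u = \<tau> *v u)"

end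

theory Submission
  imports Defs
begin

text \<open>
  Two matrices agree on a nonzero vector iff their difference is singular, so an intersecting set
  is a set of matrices whose pairwise differences have determinant zero. Sets of \<open>2 \<times> 2\<close> matrices
  with this property are of two kinds: either all members agree on one common nonzero vector, or all
  their transposes do (lemma \<open>pairwise_singular_differences_cases\<close>). The reason is that a matrix of
  rank one can be brought to the form \<open>E\<^sub>1\<^sub>1\<close> by multiplication from both sides; the members of a
  pairwise singular set that contains \<open>0\<close> and \<open>E\<^sub>1\<^sub>1\<close> then vanish outside the first row or outside
  the first column, and two members that leave the first row and the first column respectively
  have an invertible difference.

  Conversely, all matrices sending \<open>u \<noteq> 0\<close> to a given \<open>v\<close> form a pairwise singular set. As \<open>G\<close>
  contains \<open>SL\<close>, it consists of all matrices whose determinant lies in \<open>det ` G\<close>; so the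
  elements of \<open>G\<close> sending \<open>u\<close> to \<open>v \<noteq> 0\<close> correspond, in bases starting with \<open>u\<close> and \<open>v\<close>, to the
  matrices with rows \<open>(1, t)\<close> and \<open>(0, s)\<close> with \<open>s \<in> det ` G\<close>. There are \<open>q * d\<close> of them. The
  same count applies to transposes, and extending the given set to all elements of \<open>G\<close> that share
  the common value (of the matrix or of its transpose) gives the required set.
\<close>

section \<open>Intersecting sets and singular differences\<close>

text \<open>
  Transposes are kept as matrices acting on columns, so that facts on determinants and kernels
  apply to them directly.
\<close>

declare transpose_matrix_vector [simp del]

lemma singular_iff_kernel_2:
  fixes M :: "'a::field^2^2"
  shows "det M = 0 \<longleftrightarrow> (\<exists>u. u \<noteq> 0 \<and> M *v u = 0)"
  using invertible_det_nz[of M] matrix_left_invertible_ker[of M]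
  by (auto simp: invertible_left_inverse)

lemma nonsingular_mult_eq_0_iff:
  fixes M :: "'a::field^2^2"
  assumes "det M \<noteq> 0"
  shows "M *v u = 0 \<longleftrightarrow> u = 0"
  using assms singular_iff_kernel_2[of M] matrix_vector_mult_0_right[of M] by blast

lemma matrix_vector_mult_axis:
  fixes M :: "'a::semiring_1^'n^'m"
  shows "M *v axis k 1 = column k M"
  by (simp add: matrix_vector_mult_def column_def axis_def vec_eq_iff if_distrib cong: if_cong)

lemma intersecting_iff_singular_differences:
  fixes A :: "('a::field^2^2) set"
  shows "intersecting A \<longleftrightarrow> (\<forall>X\<in>A. \<forall>Y\<in>A. det (X - Y) = 0)"
  unfolding intersecting_def singular_iff_kernel_2 by (simp add: matrix_vector_mult_diff_rdistrib)

lemma intersecting_image_transpose: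
  fixes A :: "('a::field^2^2) set"
  shows "intersecting (transpose ` A) \<longleftrightarrow> intersecting A"
proof -
  have "transpose X - transpose Y = transpose (X - Y)" for X Y :: "'a^2^2"
    by (simp add: transpose_def vec_eq_iff)
  then show ?thesis
    by (simp add: intersecting_iff_singular_differences det_transpose)
qed

section \<open>Pairwise singular sets of two by two matrices\<close>

text \<open>
  Every nonzero vector is part of a unimodular basis, in either position. The inverse is provided
  along with the basis because it is used for changing coordinates.
\<close>

lemma unimodular_completion:
  fixes u :: "'a::field^2"
  assumes "u \<noteq> 0"
  obtains P P' where "det P = 1" "det P' = 1" "P ** P' = mat 1" "P' ** P = mat 1"
    "P *v axis j 1 = u" "P' *v u = axis j 1"
proof -
  have "\<exists>P. det P = 1 \<and> P *v axis j 1 = u"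
  proof -
    \<comment> \<open>The sign \<open>e\<close> makes the determinant \<open>1\<close> whichever column \<open>u\<close> occupies.\<close>
    \<comment> \<open>The other column \<open>w\<close> has its only nonzero entry opposite a nonzero entry of \<open>u\<close>.\<close>
    define e :: 'a where "e = (if j = 1 then 1 else - 1)"
    define w :: "'a^2"
      where "w = (if u $ 1 = 0 then vector [- e / u $ 2, 0] else vector [0, e / u $ 1])"
    define P :: "'a^2^2" where "P = (\<chi> i k. if k = j then u $ i else w $ i)"
    have "P *v axis j 1 = u"
      by (simp add: matrix_vector_mult_axis column_def P_def vec_eq_iff)
    moreover have "det P = 1"
      using assms exhaust_2[of j]
      by (auto simp: det_2 P_def w_def e_def vec_eq_iff forall_2)
    ultimately show ?thesis by blast
  qed
  then obtain P where P: "det P = 1" "P *v axis j 1 = u" by blast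
  then have "invertible P" by (simp add: invertible_det_nz)
  then obtain P' where P': "P ** P' = mat 1" "P' ** P = mat 1"
    by (auto simp: invertible_def)
  have "det P * det P' = 1" using P'(1) det_mul[of P P'] by (simp add: det_I)
  with P have "det P' = 1" by simp
  moreover have "P' *v u = axis j 1"
    using P P' by (metis matrix_vector_mul_assoc matrix_vector_mul_lid)
  ultimately show thesis using that P P' by blast
qed

text \<open>
  A singular nonzero \<open>X\<close> kills the second vector of some unimodular basis and not the first one. The
  image of the first vector then serves as the first vector of a basis of the target space, and in
  these two bases \<open>X\<close> becomes \<open>E\<^sub>1\<^sub>1\<close>.
\<close>

lemma rank_one_normal_form:
  fixes X :: "'a::field^2^2"
  assumes "det X = 0" "X \<noteq> 0"
  obtains P Q where "det P = 1" "det Q = 1"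
    "P ** X ** Q = (\<chi> i j. if i = 1 \<and> j = 1 then 1 else 0)"
proof -
  obtain x where x: "x \<noteq> 0" "X *v x = 0" using assms singular_iff_kernel_2 by blast
  obtain Q Q' where Q: "det Q = 1" "Q ** Q' = mat 1" "Q *v axis 2 1 = x"
    by (rule unimodular_completion[OF x(1), of 2])
  have col2: "column 2 (X ** Q) = 0"
    using x Q(3) by (metis matrix_vector_mult_axis matrix_vector_mul_assoc)
  have col1: "column 1 (X ** Q) \<noteq> 0"
  proof
    assume "column 1 (X ** Q) = 0"
    with col2 have "X ** Q = 0" by (simp add: column_def vec_eq_iff forall_2)
    then have "X ** Q ** Q' = 0" by simp
    with Q(2) assms(2) show False by (simp flip: matrix_mul_assoc)
  qed
  obtain P where P: "det P = 1" "P *v column 1 (X ** Q) = axis 1 1"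
    by (rule unimodular_completion[OF col1, of 1])
  have "column k (P ** X ** Q) = P *v column k (X ** Q)" for k
    by (simp add: matrix_vector_mul_assoc matrix_mul_assoc flip: matrix_vector_mult_axis)
  then have "column 1 (P ** X ** Q) = axis 1 1" "column 2 (P ** X ** Q) = 0"
    using P(2) col2 by simp_all
  then have "P ** X ** Q = (\<chi> i j. if i = 1 \<and> j = 1 then 1 else 0)"
    by (simp add: column_def vec_eq_iff forall_2 axis_def)
  with P(1) Q(1) show thesis by (rule that)
qed

text \<open>
  In the coordinates that turn one nonzero member into \<open>E\<^sub>1\<^sub>1\<close>, singularity of \<open>Y\<close> and of \<open>Y - E\<^sub>1\<^sub>1\<close>
  forces \<open>Y\<^sub>2\<^sub>2 = 0\<close> and \<open>Y\<^sub>1\<^sub>2 Y\<^sub>2\<^sub>1 = 0\<close>. Two members \<open>Y\<close> and \<open>Z\<close> satisfy \<open>Y\<^sub>1\<^sub>2 Z\<^sub>2\<^sub>1 = 0\<close> as well, because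
  \<open>Y - Z\<close> is singular. Hence all \<open>Y\<^sub>1\<^sub>2\<close> vanish or all \<open>Y\<^sub>2\<^sub>1\<close> do.
\<close>

lemma pairwise_singular_with_zero_cases:
  fixes S :: "('a::field^2^2) set"
  assumes "0 \<in> S" and sing: "\<And>X Y. X \<in> S \<Longrightarrow> Y \<in> S \<Longrightarrow> det (X - Y) = 0"
  shows "(\<exists>u. u \<noteq> 0 \<and> (\<forall>Y\<in>S. Y *v u = 0)) \<or> (\<exists>u. u \<noteq> 0 \<and> (\<forall>Y\<in>S. transpose Y *v u = 0))"
proof (cases "\<forall>X\<in>S. X = 0")
  case True
  then have "axis 1 (1::'a) \<noteq> 0 \<and> (\<forall>Y\<in>S. Y *v axis (1::2) 1 = 0)" by auto
  then show ?thesis by blast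
next
  case False
  then obtain X where X: "X \<in> S" "X \<noteq> 0" by blast
  have det0: "det Y = 0" if "Y \<in> S" for Y using sing[OF that assms(1)] by simp
  obtain P Q where P: "det P = 1" and Q: "det Q = 1"
    and norm: "P ** X ** Q = (\<chi> i j. if i = 1 \<and> j = 1 then 1 else 0)"
    by (rule rank_one_normal_form[OF det0[OF X(1)] X(2)])
  define f where "f Y = P ** Y ** Q" for Y
  have det_f: "det (f Y) = 0" if "Y \<in> S" for Y
    using det0[OF that] by (simp add: f_def det_mul)
  have det_f_diff: "det (f Y - f Z) = 0" if "Y \<in> S" "Z \<in> S" for Y Z
  proof -
    have "f Y - f Z = P ** (Y - Z) ** Q"
      by (simp add: f_def matrix_matrix_mult_def vec_eq_iff sum_2 algebra_simps)
    then show ?thesis using sing[OF that] by (simp add: det_mul)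
  qed
  have f_X: "f X = (\<chi> i j. if i = 1 \<and> j = 1 then 1 else 0)" using norm by (simp add: f_def)
  have f22: "f Y $ 2 $ 2 = 0" if "Y \<in> S" for Y
    using det_f[OF that] det_f_diff[OF that X(1)] by (simp add: f_X det_2 algebra_simps)
  have f12_f21: "f Y $ 1 $ 2 * f Z $ 2 $ 1 = 0" if "Y \<in> S" "Z \<in> S" for Y Z
    using det_f[OF that(1)] det_f[OF that(2)] det_f_diff[OF that] f22[OF that(1)] f22[OF that(2)]
    by (auto simp: det_2)
  consider "\<forall>Y\<in>S. f Y $ 1 $ 2 = 0" | "\<forall>Y\<in>S. f Y $ 2 $ 1 = 0"
    using f12_f21 by fastforce
  then show ?thesis
  proof cases
    case 1
    have "Q *v axis 2 1 \<noteq> 0"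
      using Q by (simp add: nonsingular_mult_eq_0_iff)
    moreover have "Y *v (Q *v axis 2 1) = 0" if "Y \<in> S" for Y
    proof -
      have "P *v (Y *v (Q *v axis 2 1)) = column 2 (f Y)"
        by (simp add: f_def matrix_vector_mul_assoc matrix_mul_assoc flip: matrix_vector_mult_axis)
      also have "\<dots> = 0" using 1 f22 that by (simp add: column_def vec_eq_iff forall_2)
      finally show ?thesis using P by (simp add: nonsingular_mult_eq_0_iff)
    qed
    ultimately show ?thesis by blast
  next
    case 2
    have "transpose P *v axis 2 1 \<noteq> 0"
      using P by (simp add: nonsingular_mult_eq_0_iff det_transpose)
    moreover have "transpose Y *v (transpose P *v axis 2 1) = 0" if "Y \<in> S" for Y
    proof -
      have "transpose Q *v (transpose Y *v (transpose P *v axis 2 1)) = column 2 (transpose (f Y))"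
        by (simp add: f_def matrix_vector_mul_assoc matrix_mul_assoc matrix_transpose_mul
            flip: matrix_vector_mult_axis)
      also have "\<dots> = 0" using 2 f22 that
        by (simp add: column_def transpose_def vec_eq_iff forall_2)
      finally show ?thesis
        using Q by (simp add: nonsingular_mult_eq_0_iff det_transpose)
    qed
    ultimately show ?thesis by blast
  qed
qed

text \<open>Translating by one member reduces to a set containing zero.\<close>

lemma pairwise_singular_differences_cases:
  fixes A :: "('a::field^2^2) set"
  assumes sing: "\<And>X Y. X \<in> A \<Longrightarrow> Y \<in> A \<Longrightarrow> det (X - Y) = 0" and "Z \<in> A"
  shows "(\<exists>u. u \<noteq> 0 \<and> (\<forall>Y\<in>A. Y *v u = Z *v u)) \<or>
    (\<exists>u. u \<noteq> 0 \<and> (\<forall>Y\<in>A. transpose Y *v u = transpose Z *v u))"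
proof -
  let ?S = "(\<lambda>Y. Y - Z) ` A"
  have "0 \<in> ?S" using \<open>Z \<in> A\<close> by force
  moreover have "det (X - Y) = 0" if "X \<in> ?S" "Y \<in> ?S" for X Y
    using that sing by auto
  ultimately have "(\<exists>u. u \<noteq> 0 \<and> (\<forall>Y\<in>?S. Y *v u = 0)) \<or>
      (\<exists>u. u \<noteq> 0 \<and> (\<forall>Y\<in>?S. transpose Y *v u = 0))"
    by (rule pairwise_singular_with_zero_cases)
  moreover have "transpose (Y - Z) = transpose Y - transpose Z" for Y
    by (simp add: transpose_def vec_eq_iff)
  ultimately show ?thesis by (simp add: matrix_vector_mult_diff_rdistrib)
qed

section \<open>Counting matrices with prescribed value and determinant\<close>

text \<open>
  In unimodular bases starting with \<open>u\<close> and \<open>v\<close> the matrix is determined by its second column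
  \<open>(t, s)\<close>, and its determinant is \<open>s\<close>.
\<close>

lemma card_matrices_with_value_and_det:
  fixes u v :: "'a::{field,finite}^2"
  assumes "u \<noteq> 0" "v \<noteq> 0"
  shows "card {M. M *v u = v \<and> det M \<in> D} = CARD('a) * card D"
proof -
  obtain P P' where P: "det P = 1" "det P' = 1" "P ** P' = mat 1" "P' ** P = mat 1"
    "P *v axis 1 1 = u" "P' *v u = axis 1 1" by (rule unimodular_completion[OF assms(1), of 1])
  obtain R R' where R: "det R = 1" "det R' = 1" "R ** R' = mat 1" "R' ** R = mat 1"
    "R *v axis 1 1 = v" "R' *v v = axis 1 1" by (rule unimodular_completion[OF assms(2), of 1])
  define N :: "'a \<times> 'a \<Rightarrow> 'a^2^2"
    where "N = (\<lambda>(t, s). vector [vector [1, t], vector [0, s]])"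
  define f where "f p = R ** N p ** P'" for p
  define g where "g M = (let K = R' ** M ** P in (K $ 1 $ 2, K $ 2 $ 2))" for M
  have N_nth: "N p $ 1 $ 2 = fst p" "N p $ 2 $ 2 = snd p" "det (N p) = snd p" for p
    by (auto simp: N_def case_prod_beta det_2)
  have N_axis: "N p *v axis 1 1 = axis 1 1" for p
    unfolding matrix_vector_mult_axis
    by (auto simp: N_def case_prod_beta column_def vec_eq_iff forall_2 axis_def)
  have N_eqI: "N (K $ 1 $ 2, K $ 2 $ 2) = K" if "K *v axis 1 1 = axis 1 1" for K
    using that unfolding matrix_vector_mult_axis
    by (auto simp: N_def column_def vec_eq_iff forall_2 axis_def)
  have R'fP: "R' ** f p ** P = N p" for p
  proof -
    have "R' ** f p ** P = (R' ** R) ** N p ** (P' ** P)" by (simp add: f_def matrix_mul_assoc)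
    then show ?thesis by (simp add: P R)
  qed
  have RgP': "R ** (R' ** M ** P) ** P' = M" for M
  proof -
    have "R ** (R' ** M ** P) ** P' = (R ** R') ** M ** (P ** P')" by (simp add: matrix_mul_assoc)
    then show ?thesis by (simp add: P R)
  qed
  have coord: "(R' ** M ** P) *v axis 1 1 = axis 1 1" if "M *v u = v" for M
    using that P(5) R(6) by (simp flip: matrix_vector_mul_assoc)
  have fg: "f (g M) = M" if "M *v u = v" for M
    using N_eqI[OF coord[OF that]] RgP'[of M] by (simp add: f_def g_def Let_def)
  have "bij_betw f (UNIV \<times> D) {M. M *v u = v \<and> det M \<in> D}"
  proof (rule bij_betw_byWitness[where f' = g])
    show "\<forall>p\<in>UNIV \<times> D. g (f p) = p" by (simp add: g_def R'fP N_nth)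
    show "\<forall>M\<in>{M. M *v u = v \<and> det M \<in> D}. f (g M) = M" using fg by simp
    show "f ` (UNIV \<times> D) \<subseteq> {M. M *v u = v \<and> det M \<in> D}"
      using P R by (auto simp: f_def det_mul N_nth N_axis simp flip: matrix_vector_mul_assoc)
    have "snd (g M) = det M" if "M *v u = v" for M
    proof -
      have "snd (g M) = det (N (g M))" by (simp add: N_nth)
      also have "\<dots> = det (f (g M))" using P R by (simp add: f_def det_mul)
      finally show ?thesis using fg[OF that] by simp
    qed
    then show "g ` {M. M *v u = v \<and> det M \<in> D} \<subseteq> UNIV \<times> D"
      by (simp add: image_subset_iff mem_Times_iff)
  qed
  then have "card {M. M *v u = v \<and> det M \<in> D} = card ((UNIV :: 'a set) \<times> D)"
    by (simp add: bij_betw_same_card)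
  then show ?thesis by (simp add: card_cartesian_product)
qed

text \<open>
  A matrix with the same determinant as some \<open>g \<in> G\<close> differs from \<open>g\<close> by a factor in \<open>SL\<close>.
\<close>

lemma subgroup_above_SL_iff_det:
  fixes G :: "('a::field^'n^'n) set"
  assumes "subgroup G GL" "SL \<subseteq> G"
  shows "M \<in> G \<longleftrightarrow> det M \<in> det ` G"
proof
  assume "det M \<in> det ` G"
  then obtain g where g: "g \<in> G" "det g = det M" by auto
  have "invertible g" using subgroup.subset[OF assms(1)] g(1) by (auto simp: GL_def)
  then obtain h where h: "g ** h = mat 1" "h ** g = mat 1" by (auto simp: invertible_def)
  have "det (M ** h) = 1" using g(2) h(1) by (metis det_I det_mul)
  then have "M ** h \<in> G" using assms(2) by (auto simp: SL_def)
  then have "(M ** h) ** g \<in> G"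
    using subgroup.m_closed[OF assms(1)] g(1) by (simp add: GL_def)
  then show "M \<in> G" using h by (simp flip: matrix_mul_assoc)
qed simp

lemma card_subgroup_elements_with_value:
  fixes G :: "('a::{field,finite}^2^2) set"
  assumes "subgroup G GL" "SL \<subseteq> G" "u \<noteq> 0" "v \<noteq> 0"
  shows "card {M \<in> G. M *v u = v} = CARD('a) * card (det ` G)"
    and "card {M \<in> G. transpose M *v u = v} = CARD('a) * card (det ` G)"
proof -
  let ?B = "{M. M *v u = v \<and> det M \<in> det ` G}"
  have "{M \<in> G. M *v u = v} = ?B"
    by (intro Collect_cong)
      (simp only: subgroup_above_SL_iff_det[OF assms(1,2), symmetric] conj_commute)
  then show "card {M \<in> G. M *v u = v} = CARD('a) * card (det ` G)"
    using card_matrices_with_value_and_det[OF assms(3,4)] by simp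
  have "M \<in> transpose ` ?B \<longleftrightarrow> transpose M \<in> ?B" for M
    by (metis (no_types, lifting) image_iff transpose_transpose)
  moreover have "det (transpose M) \<in> det ` G \<longleftrightarrow> M \<in> G" for M
    by (simp only: subgroup_above_SL_iff_det[OF assms(1,2), symmetric] det_transpose)
  ultimately have "{M \<in> G. transpose M *v u = v} = transpose ` ?B"
    by (intro Set.set_eqI) (simp only: mem_Collect_eq conj_commute)
  moreover have "inj_on transpose ?B"
    by (rule inj_on_inverseI[where g = transpose]) (rule transpose_transpose)
  ultimately show "card {M \<in> G. transpose M *v u = v} = CARD('a) * card (det ` G)"
    using card_matrices_with_value_and_det[OF assms(3,4)] by (simp add: card_image)
qed

section \<open>Extending intersecting sets\<close>

theorem theorem11:
  fixes G A :: "('a::{field,finite}^2^2) set" and q d :: nat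
  assumes "q = CARD('a)"
    and "subgroup G GL"
    and "SL \<subset> G"
    and "d = card (det ` G)"
    and "A \<subseteq> G"
    and "intersecting A"
  shows "\<exists>B. B \<subseteq> G \<and> intersecting B \<and> A \<subseteq> B \<and> card B = q * d"
proof -
  have SL: "SL \<subseteq> G" using assms(3) by blast
  have point: "intersecting {M \<in> G. M *v u = v}" if "u \<noteq> 0" for u v
    using that by (auto simp: intersecting_def)
  have line: "intersecting {M \<in> G. transpose M *v u = v}" if "u \<noteq> 0" for u v
  proof -
    have "intersecting (transpose ` {M \<in> G. transpose M *v u = v})"
      using that by (auto simp: intersecting_def)
    then show ?thesis by (simp only: intersecting_image_transpose)
  qed
  \<comment> \<open>\<open>Z\<close> fixes the common value. It is a member of \<open>A\<close>, and the identity if \<open>A\<close> is empty.\<close>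
  obtain Z where Z: "Z \<in> G"
    and cases: "(\<exists>u. u \<noteq> 0 \<and> (\<forall>Y\<in>A. Y *v u = Z *v u)) \<or>
      (\<exists>u. u \<noteq> 0 \<and> (\<forall>Y\<in>A. transpose Y *v u = transpose Z *v u))"
  proof (cases "A = {}")
    case True
    have "mat 1 \<in> G" using SL by (auto simp: SL_def det_I)
    moreover have "axis (1::2) (1::'a) \<noteq> 0" by simp
    ultimately show thesis using that True by blast
  next
    case False
    then obtain Z where "Z \<in> A" by blast
    moreover have "det (X - Y) = 0" if "X \<in> A" "Y \<in> A" for X Y
      using that assms(6) by (simp add: intersecting_iff_singular_differences)
    ultimately show thesis
      using that assms(5) pairwise_singular_differences_cases[of A Z] by blast
  qed
  have "invertible Z" using subgroup.subset[OF assms(2)] Z by (auto simp: GL_def)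
  then have detZ: "det Z \<noteq> 0" by (simp add: invertible_det_nz)
  from cases show ?thesis
  proof (elim disjE exE conjE)
    fix u assume u: "u \<noteq> 0" and A: "\<forall>Y\<in>A. Y *v u = Z *v u"
    have "Z *v u \<noteq> 0" using u detZ by (simp add: nonsingular_mult_eq_0_iff)
    then have "card {M \<in> G. M *v u = Z *v u} = q * d"
      using card_subgroup_elements_with_value(1)[OF assms(2) SL u] assms(1,4) by simp
    then show ?thesis using point[OF u] A assms(5)
      by (intro exI[of _ "{M \<in> G. M *v u = Z *v u}"]) auto
  next
    fix u assume u: "u \<noteq> 0" and A: "\<forall>Y\<in>A. transpose Y *v u = transpose Z *v u"
    have "transpose Z *v u \<noteq> 0"
      using u detZ by (simp add: nonsingular_mult_eq_0_iff det_transpose)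
    then have "card {M \<in> G. transpose M *v u = transpose Z *v u} = q * d"
      using card_subgroup_elements_with_value(2)[OF assms(2) SL u] assms(1,4) by simp
    then show ?thesis using line[OF u] A assms(5)
      by (intro exI[of _ "{M \<in> G. transpose M *v u = transpose Z *v u}"]) auto
  qed
qed

end
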